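(* Let $\rho:|G|\hookrightarrow GL(V)$ with $\dim_{\mathbb R} V=3$ be a faithful representation of a finite group $|G|$ such that the linear group $\rho(|G|)$ is strictly generated in codimension two. For $n\ge 1$, let $\operatorname{diag}_nG$ be the linear group given by the faithful representation $$|G|\xrightarrow{\ \rho\times\dots\times\rho\ }GL(V^n),$$ i.e. $g$ acts on $V^n=V\times\dots\times V$ by $\rho(g)$ on each factor. Then $\operatorname{diag}_nG$ is a linear group of rank $3n$ that is strictly generated in codimension $2n$.
   Context: For a finite linear group $G\subset GL(U)$ on a finite-dimensional real vector space $U$, the rank of $G$ is $\dim U$; for $g\in G$, $U^{\langle g\rangle}$ is the subspace of vectors fixed by $g$. $G$ is strictly generated in codimension $k$ if it is generated by its elements $g$ with $\operatorname{codim}U^{\langle g\rangle}=k$. *)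

theory Defs
  imports "HOL-Analysis.Finite_Cartesian_Product" "HOL-Algebra.Generated_Groups"
begin

text \<open>A vector space is a type of class \<^class>\<open>real_vector\<close>; no norm or inner product is chosen on it.\<close>

definition GL :: "('u::real_vector \<Rightarrow> 'u) monoid" where
  "GL = \<lparr>carrier = {f. linear f \<and> bij f}, mult = (\<circ>), one = id\<rparr>"

definition finite_linear_group :: "('u::real_vector \<Rightarrow> 'u) set \<Rightarrow> bool" where
  "finite_linear_group G \<longleftrightarrow>
     (\<exists>B::'u set. finite B \<and> span B = UNIV) \<and> subgroup G GL \<and> finite G"

text \<open>The rank depends on \<open>G\<close> only through the space on which it acts, that is, through its type.\<close>

definition linear_group_rank :: "('u::real_vector \<Rightarrow> 'u) set \<Rightarrow> nat" where
  "linear_group_rank G = dim (UNIV :: 'u set)"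

definition fixed_space :: "('u::real_vector \<Rightarrow> 'u) \<Rightarrow> 'u set" where
  "fixed_space g = {u. g u = u}"

text \<open>The subtraction does not truncate on a finite-dimensional space, the only case in which
  \<open>codim\<close> is used (an infinite-dimensional space has \<^const>\<open>dim\<close> equal to 0).\<close>

definition codim :: "'u::real_vector set \<Rightarrow> nat" where
  "codim W = dim (UNIV :: 'u set) - dim W"

definition strictly_generated_in_codim :: "nat \<Rightarrow> ('u::real_vector \<Rightarrow> 'u) set \<Rightarrow> bool" where
  "strictly_generated_in_codim k G \<longleftrightarrow>
     generate GL {g \<in> G. codim (fixed_space g) = k} = G"

definition faithful_rep :: "('g, 'm) monoid_scheme \<Rightarrow> ('g \<Rightarrow> 'u::real_vector \<Rightarrow> 'u) \<Rightarrow> bool" where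
  "faithful_rep \<Gamma> \<rho> \<longleftrightarrow> \<rho> \<in> hom \<Gamma> GL \<and> inj_on \<rho> (carrier \<Gamma>)"

text \<open>The power \<open>V\<^sup>n\<close> is the type \<open>'v ^ 'n\<close> with \<open>CARD('n) = n\<close>.\<close>

definition diag_rep :: "('g \<Rightarrow> 'v \<Rightarrow> 'v) \<Rightarrow> 'g \<Rightarrow> 'v ^ 'n \<Rightarrow> 'v ^ 'n" where
  "diag_rep \<rho> g v = (\<chi> i. \<rho> g (v $ i))"

end

theory Submission
  imports Defs
begin

text \<open>Coordinatewise application of a map is an injective homomorphism from \<open>GL(V)\<close> to
  \<open>GL(V\<^sup>n)\<close> that replaces the fixed space \<open>W\<close> by \<open>W\<^sup>n\<close>. It therefore multiplies the codimension
  of every fixed space by \<open>n\<close>, and it carries generating sets of a group to generating sets of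
  the image.\<close>

lemma group_GL: "group (GL :: ('u::real_vector \<Rightarrow> 'u) monoid)"
proof (rule groupI)
  fix f :: "'u \<Rightarrow> 'u"
  assume "f \<in> carrier GL"
  then have f: "linear f" "bij f"
    by (auto simp: GL_def)
  then obtain g where g: "linear g" "g \<circ> f = id"
    using linear_injective_left_inverse bij_is_inj by blast
  \<comment> \<open>The map \<open>g\<close> is so far only a left inverse; it is bijective because
    \<open>f\<close> and the composite \<open>id\<close> are.\<close>
  moreover have "bij g"
    using f(2) g(2) by (metis bij_betw_comp_iff bij_id)
  ultimately show "\<exists>g\<in>carrier GL. g \<otimes>\<^bsub>GL\<^esub> f = \<one>\<^bsub>GL\<^esub>"
    by (auto simp: GL_def)
qed (auto simp: GL_def o_assoc linear_compose bij_comp linear_id[unfolded id_def] id_def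
      bij_id[unfolded id_def])

lemma linear_vec_nth: "linear (\<lambda>v :: 'v::real_vector ^ 'n. v $ i)"
  by (rule linearI) simp_all

lemma linear_axis: "linear (axis i :: 'v::real_vector \<Rightarrow> 'v ^ 'n)"
  by (rule linearI) (simp_all add: vec_eq_iff axis_def)

lemma vec_eq_sum_axis: "v = (\<Sum>i\<in>UNIV. axis i (v $ i))" for v :: "'v::real_vector ^ 'n::finite"
  by (simp add: vec_eq_iff axis_def)

text \<open>A basis of the power is obtained from a basis \<open>B\<close> of \<open>W\<close> by
  placing each vector of \<open>B\<close> in each single coordinate, with 0 in all the
  others.\<close>

lemma dim_power_subspace:
  fixes W :: "'v::real_vector set"
  assumes W: "subspace W"
  shows "dim {v :: 'v ^ 'n::finite. \<forall>i. v $ i \<in> W} = CARD('n) * dim W"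
proof -
  obtain B where B: "B \<subseteq> W" "independent B" "W \<subseteq> span B" "card B = dim W"
    by (rule real_vector.basis_exists)
  define S :: "('v ^ 'n) set" where "S = (\<lambda>(i, b). axis i b) ` (UNIV \<times> B)"
  \<comment> \<open>A zero vector would give the same \<open>axis i 0\<close> for every
    \<open>i\<close>, and the count of \<open>S\<close> would fail.\<close>
  have "0 \<notin> B"
    using B(2) real_vector.dependent_zero by blast
  then have "inj_on (\<lambda>(i, b). axis i b :: 'v ^ 'n) (UNIV \<times> B)"
    by (auto simp: inj_on_def axis_eq_axis)
  then have card: "card S = CARD('n) * dim W"
    by (simp add: S_def card_image card_cartesian_product B(4))
  have sub: "S \<subseteq> {v. \<forall>i. v $ i \<in> W}"
    using B(1) real_vector.subspace_0[OF W] by (auto simp: S_def axis_def)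
  have "{v. \<forall>i. v $ i \<in> W} \<subseteq> span S"
  proof
    fix v :: "'v ^ 'n"
    assume v: "v \<in> {v. \<forall>i. v $ i \<in> W}"
    have "axis i (v $ i) \<in> span S" for i
    proof -
      have "axis i (v $ i) \<in> axis i ` span B"
        using v B(3) by blast
      also have "\<dots> = span (axis i ` B)"
        by (rule linear_span_image[OF linear_axis, symmetric])
      also have "\<dots> \<subseteq> span S"
        by (intro real_vector.span_mono) (auto simp: S_def)
      finally show ?thesis .
    qed
    then show "v \<in> span S"
      by (subst vec_eq_sum_axis) (intro real_vector.span_sum)
  qed
  moreover have "independent S"
  proof
    assume "dependent S"
    then obtain i b where b: "b \<in> B" and "axis i b \<in> span (S - {axis i b})"
      unfolding real_vector.dependent_def by (auto simp: S_def)
    moreover have component: "axis j c $ i = (if i = j then c else 0)" for j and c :: 'v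
      by (simp add: axis_def)
    \<comment> \<open>Reading off coordinate \<open>i\<close> sends \<open>axis i b\<close> to
      \<open>b\<close> and every other element of \<open>S\<close> to 0 or into
      \<open>B - {b}\<close>, so a dependence in \<open>S\<close> would descend to one in
      \<open>B\<close>.\<close>
    ultimately have "b \<in> (\<lambda>v. v $ i) ` span (S - {axis i b})"
      by (metis image_eqI)
    also have "\<dots> = span ((\<lambda>v. v $ i) ` (S - {axis i b}))"
      by (rule linear_span_image[OF linear_vec_nth, symmetric])
    also have "\<dots> \<subseteq> span (insert 0 (B - {b}))"
      by (intro real_vector.span_mono) (auto simp: S_def component split: if_splits)
    finally have "b \<in> span (B - {b})"
      by (simp add: real_vector.span_insert_0)
    with b B(2) show False
      unfolding real_vector.dependent_def by blast
  qed
  ultimately show ?thesis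
    using sub card by (intro real_vector.dim_unique)
qed

lemma dim_vec_UNIV:
  "dim (UNIV :: ('v::real_vector ^ 'n::finite) set) = CARD('n) * dim (UNIV :: 'v set)"
  using dim_power_subspace[OF real_vector.subspace_UNIV, where 'n = 'n] by simp

text \<open>The value of \<open>dim\<close> is the cardinality of a basis, and an infinite set has
  cardinality 0. A positive value therefore certifies finite dimension.\<close>

lemma finite_spanning_set_if_dim_pos:
  assumes "0 < dim (UNIV :: 'u::real_vector set)"
  shows "\<exists>B::'u set. finite B \<and> span B = UNIV"
proof -
  obtain B :: "'u set" where "UNIV \<subseteq> span B" "card B = dim (UNIV :: 'u set)"
    using real_vector.basis_exists by metis
  with assms show ?thesis
    by (metis card_gt_0_iff top.extremum_uniqueI)
qed

lemma subspace_fixed_space: "linear f \<Longrightarrow> subspace (fixed_space f)"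
  by (auto simp: fixed_space_def real_vector.subspace_def linear_0 linear_add linear_scale)

text \<open>With \<^const>\<open>id\<close> in place of the representation, \<^const>\<open>diag_rep\<close> is the homomorphism from
  \<open>GL(V)\<close> to \<open>GL(V\<^sup>n)\<close> itself.\<close>

lemma diag_rep_eq: "diag_rep \<rho> g = diag_rep id (\<rho> g)"
  by (simp add: diag_rep_def fun_eq_iff)

lemma fixed_space_diag_rep: "fixed_space (diag_rep id f) = {v. \<forall>i. v $ i \<in> fixed_space f}"
  by (simp add: fixed_space_def diag_rep_def vec_eq_iff)

text \<open>Both dimensions in the difference are multiplied by \<open>CARD('n)\<close>, and
  multiplication distributes over subtraction of natural numbers even when it truncates.\<close>

lemma codim_fixed_space_diag_rep:
  fixes f :: "'v::real_vector \<Rightarrow> 'v"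
  assumes "linear f"
  shows "codim (fixed_space (diag_rep id f :: 'v ^ 'n::finite \<Rightarrow> 'v ^ 'n))
    = CARD('n) * codim (fixed_space f)"
  by (simp add: codim_def fixed_space_diag_rep dim_power_subspace subspace_fixed_space assms
      dim_vec_UNIV diff_mult_distrib2)

lemma diag_rep_comp: "diag_rep id (f \<circ> g) = diag_rep id f \<circ> diag_rep id g"
  by (simp add: diag_rep_def fun_eq_iff)

lemma diag_rep_id: "diag_rep id id = id"
  by (simp add: diag_rep_def fun_eq_iff)

lemma inj_diag_rep: "inj (diag_rep id :: ('v \<Rightarrow> 'v) \<Rightarrow> 'v ^ 'n::finite \<Rightarrow> 'v ^ 'n)"
proof (rule injI, rule ext)
  fix f g :: "'v \<Rightarrow> 'v" and x
  assume "(diag_rep id f :: 'v ^ 'n \<Rightarrow> 'v ^ 'n) = diag_rep id g"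
  \<comment> \<open>Constant vectors recover the map, since the index type has at least one
    element.\<close>
  then have "diag_rep id f (\<chi> i::'n. x) = diag_rep id g (\<chi> i. x)"
    by simp
  then show "f x = g x"
    by (simp add: diag_rep_def vec_eq_iff)
qed

lemma diag_rep_in_GL:
  fixes f :: "'v::real_vector \<Rightarrow> 'v"
  assumes "f \<in> carrier GL"
  shows "(diag_rep id f :: 'v ^ 'n::finite \<Rightarrow> 'v ^ 'n) \<in> carrier GL"
proof -
  have f: "linear f" "bij f"
    using assms by (auto simp: GL_def)
  have "linear (diag_rep id f :: 'v ^ 'n \<Rightarrow> 'v ^ 'n)"
    by (rule linearI) (simp_all add: diag_rep_def vec_eq_iff linear_add linear_scale f)
  moreover have "bij (diag_rep id f :: 'v ^ 'n \<Rightarrow> 'v ^ 'n)"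
    \<comment> \<open>The two-sided inverse is the coordinatewise inverse of
      \<open>f\<close>.\<close>
    by (rule o_bij[of "diag_rep id (inv_into UNIV f)"])
      (use f in \<open>simp_all flip: diag_rep_comp add: bij_is_inj bij_is_surj surj_iff[THEN iffD1] diag_rep_id\<close>)
  ultimately show ?thesis
    by (simp add: GL_def)
qed

lemma group_hom_diag_rep:
  "group_hom GL GL (diag_rep id :: ('v::real_vector \<Rightarrow> 'v) \<Rightarrow> 'v ^ 'n::finite \<Rightarrow> 'v ^ 'n)"
proof -
  have "diag_rep id \<in> hom GL (GL :: ('v ^ 'n \<Rightarrow> 'v ^ 'n) monoid)"
    by (rule homI) (simp_all add: diag_rep_in_GL, simp add: GL_def diag_rep_comp)
  then show ?thesis
    by (simp add: group_hom_def group_hom_axioms_def group_GL)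
qed

lemma strictly_generated_in_codim_diag_rep:
  assumes G: "G \<subseteq> carrier GL" and gen: "strictly_generated_in_codim k G"
  shows "strictly_generated_in_codim (k * CARD('n))
    ((diag_rep id :: ('v::real_vector \<Rightarrow> 'v) \<Rightarrow> 'v ^ 'n::finite \<Rightarrow> 'v ^ 'n) ` G)"
proof -
  let ?d = "diag_rep id :: ('v \<Rightarrow> 'v) \<Rightarrow> 'v ^ 'n \<Rightarrow> 'v ^ 'n"
  let ?K = "{g \<in> G. codim (fixed_space g) = k}"
  \<comment> \<open>The factor \<open>CARD('n)\<close> is positive and can be cancelled, so the
    elements of the required codimension in the image are exactly the images of those of codimension
    \<open>k\<close>.\<close>
  have "codim (fixed_space (?d g)) = k * CARD('n) \<longleftrightarrow> codim (fixed_space g) = k" if "g \<in> G" for g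
    using that G by (subst codim_fixed_space_diag_rep) (auto simp: GL_def)
  then have "{h \<in> ?d ` G. codim (fixed_space h) = k * CARD('n)} = ?d ` ?K"
    by auto
  moreover have "generate GL (?d ` ?K) = ?d ` generate GL ?K"
    using G by (intro group_hom.generate_img[OF group_hom_diag_rep]) auto
  ultimately show ?thesis
    using gen by (simp add: strictly_generated_in_codim_def)
qed

theorem proposition5p4:
  fixes \<Gamma> :: "('g, 'm) monoid_scheme"
    and \<rho> :: "'g \<Rightarrow> 'v::real_vector \<Rightarrow> 'v"
  assumes "group \<Gamma>" and "finite (carrier \<Gamma>)"
    and "dim (UNIV :: 'v set) = 3"
    and "faithful_rep \<Gamma> \<rho>"
    and "strictly_generated_in_codim 2 (\<rho> ` carrier \<Gamma>)"
  defines "diagG \<equiv> (diag_rep \<rho> :: 'g \<Rightarrow> 'v ^ 'n::finite \<Rightarrow> 'v ^ 'n) ` carrier \<Gamma>"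
  shows "faithful_rep \<Gamma> (diag_rep \<rho> :: 'g \<Rightarrow> 'v ^ 'n \<Rightarrow> 'v ^ 'n)
    \<and> finite_linear_group diagG
    \<and> linear_group_rank diagG = 3 * CARD('n)
    \<and> strictly_generated_in_codim (2 * CARD('n)) diagG"
proof -
  let ?d = "diag_rep id :: ('v \<Rightarrow> 'v) \<Rightarrow> 'v ^ 'n \<Rightarrow> 'v ^ 'n"
  have \<rho>: "\<rho> \<in> hom \<Gamma> GL" "inj_on \<rho> (carrier \<Gamma>)"
    using assms(4) by (auto simp: faithful_rep_def)
  \<comment> \<open>Factoring through \<open>GL\<close> of the original space turns every claim into
    one about the injective homomorphism \<open>?d\<close>.\<close>
  have diag: "diag_rep \<rho> = ?d \<circ> \<rho>"
    by (rule ext) (simp add: diag_rep_eq[of \<rho>])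
  have hom: "?d \<circ> \<rho> \<in> hom \<Gamma> GL"
    using \<rho>(1) group_hom.homh[OF group_hom_diag_rep] by (rule hom_compose)
  have faithful: "faithful_rep \<Gamma> (?d \<circ> \<rho>)"
    using hom comp_inj_on[OF \<rho>(2) inj_on_subset[OF inj_diag_rep]]
    by (simp add: faithful_rep_def)
  have rank: "dim (UNIV :: ('v ^ 'n) set) = 3 * CARD('n)"
    by (simp add: dim_vec_UNIV assms(3))
  have "subgroup ((?d \<circ> \<rho>) ` carrier \<Gamma>) GL"
    using assms(1) hom
    by (intro group_hom.img_is_subgroup) (simp add: group_hom_def group_hom_axioms_def group_GL)
  \<comment> \<open>The rank \<open>3 * CARD('n)\<close> is positive, which yields the finite
    spanning set that \<open>finite_linear_group\<close> demands.\<close>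
  then have "finite_linear_group ((?d \<circ> \<rho>) ` carrier \<Gamma>)"
    using assms(2) finite_spanning_set_if_dim_pos[where ?'u = "'v ^ 'n"] rank
    by (simp add: finite_linear_group_def)
  moreover have "strictly_generated_in_codim (2 * CARD('n)) (?d ` \<rho> ` carrier \<Gamma>)"
    using \<rho>(1) assms(5) by (intro strictly_generated_in_codim_diag_rep) (auto simp: hom_def)
  ultimately show ?thesis
    using faithful rank by (simp add: diagG_def diag linear_group_rank_def image_comp)
qed

end
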